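(* A matroidal binary function is linear if and only if it has no minor isomorphic to $f_{\mathcal{U}_{2,4}}\colon 2^{\{a,b,c,d\}}\to\mathbb{R}$, where $f_{\mathcal{U}_{2,4}}(X)=0$ if $|X|\in\{1,2\}$, $f_{\mathcal{U}_{2,4}}(X)=1$ if $|X|\in\{0,3\}$, and $f_{\mathcal{U}_{2,4}}(X)=-1$ if $|X|=4$.
   Context: A binary function on a finite ground set $E$ is a function $f\colon 2^E\to\mathbb{R}$ with $f(\emptyset)=1$. Its rank function $Qf\colon 2^E\to\mathbb{R}$ is $Qf(X)=\log_2\left(\frac{\sum_{Y\subseteq E} f(Y)}{\sum_{Y\subseteq E\setminus X} f(Y)}\right)$; $f$ is rankable if $Qf(X)$ is well defined for every $X\subseteq E$. The binary function $f$ is matroidal if it is rankable and $Qf$ is a matroid rank function: $Qf(X)$ is a nonnegative integer with $Qf(X)\leq|X|$ for all $X\subseteq E$, $Qf(X)\leq Qf(X\cup\{e\})$ for all $X\subseteq E$, $e\in E\setminus X$, and $Qf(X)+Qf(X\cup\{a,b\})\leq Qf(X\cup\{a\})+Qf(X\cup\{b\})$ for all $X\subseteq E$ and distinct $a,b\in E\setminus X$. A binary function $f$ is linear if it is $\{0,1\}$-valued and for all $X,Y\subseteq E$, $f(X)=f(Y)=1$ implies $f(X\triangle Y)=1$. For $X\subseteq E$, the contraction $f/X\colon 2^{E\setminus X}\to\mathbb{R}$ is $f/X(Y)=f(Y)$, and the deletion $f\setminus X\colon 2^{E\setminus X}\to\mathbb{R}$ is $f\setminus X(Y)=\frac{\sum_{Z\subseteq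 X} f(Y\cup Z)}{\sum_{Z\subseteq X} f(Z)}$, well defined exactly when the denominator is nonzero. A minor of $f$ is a well-defined binary function $(f/X)\setminus Y$ for disjoint $X,Y\subseteq E$. Two binary functions $f$ on $E$ and $f'$ on $E'$ are isomorphic if there is a bijection $\phi\colon E\to E'$ with $f(X)=f'(\phi(X))$ for all $X\subseteq E$. *)

theory Defs
  imports Complex_Main "HOL-Library.FuncSet"
begin

text \<open>
  A binary function on a finite ground set is given by the pair of its ground set \<open>E\<close> and a function
  on sets of which only the values on \<open>Pow E\<close> are meaningful.
\<close>

definition binary_function :: "'a set \<Rightarrow> ('a set \<Rightarrow> real) \<Rightarrow> bool" where
  "binary_function E f \<longleftrightarrow> finite E \<and> f {} = 1"

definition rank_ratio :: "'a set \<Rightarrow> ('a set \<Rightarrow> real) \<Rightarrow> 'a set \<Rightarrow> real" where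
  "rank_ratio E f X = (\<Sum>Y\<in>Pow E. f Y) / (\<Sum>Y\<in>Pow (E - X). f Y)"

definition Q :: "'a set \<Rightarrow> ('a set \<Rightarrow> real) \<Rightarrow> 'a set \<Rightarrow> real" where
  "Q E f X = log 2 (rank_ratio E f X)"

text \<open>
  Division and \<open>log\<close> are total in HOL; rankability says explicitly that the quotient has a nonzero
  denominator and lies in the domain of the real logarithm.
\<close>

definition rankable :: "'a set \<Rightarrow> ('a set \<Rightarrow> real) \<Rightarrow> bool" where
  "rankable E f \<longleftrightarrow>
     (\<forall>X\<subseteq>E. (\<Sum>Y\<in>Pow (E - X). f Y) \<noteq> 0 \<and> rank_ratio E f X > 0)"

definition matroid_rank_function :: "'a set \<Rightarrow> ('a set \<Rightarrow> real) \<Rightarrow> bool" where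
  "matroid_rank_function E r \<longleftrightarrow>
     (\<forall>X\<subseteq>E. r X \<in> \<nat> \<and> r X \<le> real (card X)) \<and>
     (\<forall>X\<subseteq>E. \<forall>e\<in>E - X. r X \<le> r (X \<union> {e})) \<and>
     (\<forall>X\<subseteq>E. \<forall>a\<in>E - X. \<forall>b\<in>E - X. a \<noteq> b \<longrightarrow>
        r X + r (X \<union> {a, b}) \<le> r (X \<union> {a}) + r (X \<union> {b}))"

definition matroidal :: "'a set \<Rightarrow> ('a set \<Rightarrow> real) \<Rightarrow> bool" where
  "matroidal E f \<longleftrightarrow> rankable E f \<and> matroid_rank_function E (Q E f)"

definition linear_bf :: "'a set \<Rightarrow> ('a set \<Rightarrow> real) \<Rightarrow> bool" where
  "linear_bf E f \<longleftrightarrow>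
     (\<forall>X\<subseteq>E. f X \<in> {0, 1}) \<and>
     (\<forall>X\<subseteq>E. \<forall>Y\<subseteq>E. f X = 1 \<and> f Y = 1 \<longrightarrow> f ((X - Y) \<union> (Y - X)) = 1)"

definition contraction :: "'a set \<Rightarrow> ('a set \<Rightarrow> real) \<Rightarrow> 'a set \<Rightarrow> ('a set \<Rightarrow> real)" where
  "contraction E f X = restrict f (Pow (E - X))"

definition deletion :: "'a set \<Rightarrow> ('a set \<Rightarrow> real) \<Rightarrow> 'a set \<Rightarrow> ('a set \<Rightarrow> real)" where
  "deletion E f X =
     restrict (\<lambda>Y. (\<Sum>Z\<in>Pow X. f (Y \<union> Z)) / (\<Sum>Z\<in>Pow X. f Z)) (Pow (E - X))"

definition deletion_well_defined :: "('a set \<Rightarrow> real) \<Rightarrow> 'a set \<Rightarrow> bool" where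
  "deletion_well_defined f X \<longleftrightarrow> (\<Sum>Z\<in>Pow X. f Z) \<noteq> 0"

definition is_minor ::
  "'a set \<Rightarrow> ('a set \<Rightarrow> real) \<Rightarrow> 'a set \<Rightarrow> ('a set \<Rightarrow> real) \<Rightarrow> bool" where
  "is_minor E' g E f \<longleftrightarrow>
     (\<exists>X Y. X \<subseteq> E \<and> Y \<subseteq> E \<and> X \<inter> Y = {} \<and>
        deletion_well_defined (contraction E f X) Y \<and>
        E' = E - X - Y \<and> g = deletion (E - X) (contraction E f X) Y)"

definition isomorphic_bf ::
  "'a set \<Rightarrow> ('a set \<Rightarrow> real) \<Rightarrow> 'b set \<Rightarrow> ('b set \<Rightarrow> real) \<Rightarrow> bool" where
  "isomorphic_bf E f E' f' \<longleftrightarrow>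
     (\<exists>\<phi>. bij_betw \<phi> E E' \<and> (\<forall>X\<subseteq>E. f X = f' (\<phi> ` X)))"

definition E_U24 :: "nat set" where
  "E_U24 = {0, 1, 2, 3}"

definition f_U24 :: "nat set \<Rightarrow> real" where
  "f_U24 X =
     (if card X \<in> {1, 2} then 0 else if card X \<in> {0, 3} then 1 else - 1)"

end

theory Submission
  imports Defs
begin

text \<open>
  Write \<open>S W\<close> for the sum of \<open>f\<close> over the subsets of \<open>W\<close>. If \<open>f\<close> is matroidal then \<open>S W = 2 ^ n W\<close>,
  where \<open>n\<close> is the nullity function of the dual of the matroid with rank function \<open>Q E f\<close>; hence adding
  an element either preserves or doubles \<open>S\<close>, and once an element doubles \<open>S\<close> it also does so over every
  larger set. These properties pass to minors, and \<open>f\<close> is determined by \<open>S\<close>.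

  Let \<open>h\<close> on \<open>E\<close> be a nonlinear minor with smallest ground set. A loop (\<open>h {e} = 1\<close>) or a parallel pair
  (\<open>h {a, b} = 1\<close>) would make \<open>h\<close> the pullback of a linear function on a smaller ground set, so \<open>h\<close>
  vanishes on singletons and pairs. On proper subsets \<open>h\<close> is 0/1-valued, and it is closed under
  symmetric differences \<open>X \<triangle> Y\<close> with \<open>X \<union> Y \<noteq> E\<close>; linearity of the single-element deletions \<open>A \<mapsto> h A + h (A \<union> {e})\<close> handles
  \<open>X \<union> Y = E\<close> and forces \<open>h E = -1\<close>. Then every triple has value 1, and a fifth element would
  produce a parallel pair from two triples, so \<open>h\<close> is the function of \<open>U\<^sub>2\<^sub>,\<^sub>4\<close>.
\<close>

section \<open>Partial sums over subsets\<close>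

definition psum :: "('a set \<Rightarrow> real) \<Rightarrow> 'a set \<Rightarrow> real" where
  "psum f W = (\<Sum>Y\<in>Pow W. f Y)"

text \<open>Unit increase and local supermodularity of a nullity function, in multiplicative form.
  Without logarithms they pass directly to minors, whose sums are rescaled sums of
  \<open>f\<close>.\<close>

definition nullity_like :: "'a set \<Rightarrow> ('a set \<Rightarrow> real) \<Rightarrow> bool" where
  "nullity_like E f \<longleftrightarrow>
     finite E \<and> f {} = 1 \<and>
     (\<forall>W\<subseteq>E. \<forall>e\<in>E - W. psum f (insert e W) \<in> {psum f W, 2 * psum f W}) \<and>
     (\<forall>W\<subseteq>E. \<forall>a\<in>E - W. \<forall>b\<in>E - W. a \<noteq> b \<longrightarrow> psum f (insert a W) = 2 * psum f W \<longrightarrow>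
        psum f (insert a (insert b W)) = 2 * psum f (insert b W))"

lemma nullity_likeD:
  assumes "nullity_like E f"
  shows "finite E" and "f {} = 1"
    and "\<And>W e. W \<subseteq> E \<Longrightarrow> e \<in> E \<Longrightarrow> e \<notin> W \<Longrightarrow> psum f (insert e W) \<in> {psum f W, 2 * psum f W}"
    and "\<And>W a b. W \<subseteq> E \<Longrightarrow> a \<in> E \<Longrightarrow> a \<notin> W \<Longrightarrow> b \<in> E \<Longrightarrow> b \<notin> W \<Longrightarrow> a \<noteq> b \<Longrightarrow>
      psum f (insert a W) = 2 * psum f W \<Longrightarrow>
      psum f (insert a (insert b W)) = 2 * psum f (insert b W)"
  using assms by (simp_all add: nullity_like_def)

abbreviation symdiff :: "'a set \<Rightarrow> 'a set \<Rightarrow> 'a set" where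
  "symdiff X Y \<equiv> (X - Y) \<union> (Y - X)"

lemma psum_empty [simp]: "psum f {} = f {}"
  by (simp add: psum_def)

lemma psum_insert:
  assumes "finite W" "e \<notin> W"
  shows "psum f (insert e W) = psum f W + psum (\<lambda>A. f (insert e A)) W"
proof -
  have "inj_on (insert e) (Pow W)"
    using assms(2) by (auto simp: inj_on_def)
  moreover have "Pow W \<inter> insert e ` Pow W = {}"
    using assms(2) by auto
  ultimately show ?thesis
    using assms by (simp add: psum_def Pow_insert sum.union_disjoint sum.reindex)
qed

lemma psum_singleton [simp]: "psum f {e} = f {} + f {e}"
  using psum_insert[of "{}" e f] by simp

text \<open>Moebius inversion on the subset lattice: by induction the terms at proper subsets agree,
  so equal sums leave equal top terms.\<close>

lemma psum_determines:
  assumes "finite W" and "\<And>V. V \<subseteq> W \<Longrightarrow> psum f V = psum g V"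
  shows "f W = g W"
  using assms
proof (induction W rule: finite_psubset_induct)
  case (psubset W)
  have IH: "f V = g V" if "V \<subset> W" for V
    using that psubset.IH psubset.prems by (meson psubset_imp_subset subset_trans)
  have split: "psum k W = k W + sum k (Pow W - {W})" for k :: "'a set \<Rightarrow> real"
    unfolding psum_def using psubset.hyps by (intro sum.remove) auto
  have "sum f (Pow W - {W}) = sum g (Pow W - {W})"
    using IH by (intro sum.cong) auto
  then show ?case
    using split[of f] split[of g] psubset.prems[of W] by simp
qed

lemma nullity_like_subset:
  assumes N: "nullity_like E f" and D: "D \<subseteq> E"
  shows "nullity_like D f"
  unfolding nullity_like_def
proof (intro conjI allI ballI impI)
  show "finite D" "f {} = 1"
    using nullity_likeD[OF N] finite_subset[OF D] by simp_all
next
  fix W e assume "W \<subseteq> D" "e \<in> D - W"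
  then show "psum f (insert e W) \<in> {psum f W, 2 * psum f W}"
    using D by (intro nullity_likeD(3)[OF N]) auto
next
  fix W a b assume "W \<subseteq> D" "a \<in> D - W" "b \<in> D - W" "a \<noteq> b"
    and d: "psum f (insert a W) = 2 * psum f W"
  then show "psum f (insert a (insert b W)) = 2 * psum f (insert b W)"
    using D by (intro nullity_likeD(4)[OF N]) auto
qed

lemma psum_pos:
  assumes "nullity_like E f" "W \<subseteq> E"
  shows "psum f W > 0"
proof -
  have "finite W"
    using nullity_likeD(1)[OF assms(1)] assms(2) finite_subset by blast
  then show ?thesis
    using assms(2)
  proof (induction W rule: finite_induct)
    case empty
    then show ?case using nullity_likeD(2)[OF assms(1)] by simp
  next
    case (insert e W)
    then have "psum f (insert e W) \<in> {psum f W, 2 * psum f W}"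
      by (intro nullity_likeD(3)[OF assms(1)]) auto
    then show ?case using insert by auto
  qed
qed

text \<open>The local doubling condition is iterated, adding the elements of \<open>W\<close> to
  \<open>U\<close> one at a time.\<close>

lemma psum_double_mono:
  assumes N: "nullity_like E f" and U: "U \<subseteq> W" "W \<subseteq> E" "e \<in> E - W"
    and double: "psum f (insert e U) = 2 * psum f U"
  shows "psum f (insert e W) = 2 * psum f W"
proof -
  have fin: "finite W"
    using nullity_likeD(1)[OF N] U finite_subset by blast
  have "psum f (insert e (U \<union> V)) = 2 * psum f (U \<union> V)" if "finite V" "V \<subseteq> E - {e}" for V
    using that
  proof (induction V rule: finite_subset_induct')
    case empty
    then show ?case using double by simp
  next
    case (insert b V)
    show ?case
    proof (cases "b \<in> U")
      case True
      then show ?thesis using insert by (simp add: insert_absorb)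
    next
      case False
      have *: "U \<union> V \<subseteq> E" "e \<in> E - (U \<union> V)" "b \<in> E - (U \<union> V)" "e \<noteq> b"
        using insert U False by auto
      have "psum f (insert e (insert b (U \<union> V))) = 2 * psum f (insert b (U \<union> V))"
        using * insert by (intro nullity_likeD(4)[OF N]) auto
      then show ?thesis by simp
    qed
  qed
  from this[of W] show ?thesis
    using U fin by (auto simp: Un_absorb1)
qed

section \<open>Loops and parallel pairs\<close>

text \<open>The map \<open>p\<close> fixes sets avoiding \<open>e\<close>, sends \<open>{e}\<close>
  to \<open>C\<close> and respects symmetric differences; since \<open>h (p X) = h X\<close>,
  linearity pulls back along it. Loops use empty \<open>C\<close>, parallel pairs a
  singleton.\<close>

lemma linear_bf_pullback:
  assumes "linear_bf (E - {e}) h" "C \<subseteq> E - {e}"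
    and eq: "\<And>A. A \<subseteq> E - {e} \<Longrightarrow> h (insert e A) = h (symdiff A C)"
  shows "linear_bf E h"
proof -
  define p where "p X = (if e \<in> X then symdiff (X - {e}) C else X)" for X
  have p: "p X \<subseteq> E - {e}" "h (p X) = h X" if "X \<subseteq> E" for X
  proof -
    show "p X \<subseteq> E - {e}"
      using that assms(2) by (auto simp: p_def)
    show "h (p X) = h X"
      using eq[of "X - {e}"] Diff_mono[OF that order_refl, of "{e}"]
      by (cases "e \<in> X") (simp_all add: p_def insert_absorb)
  qed
  have sd: "p (symdiff X Y) = symdiff (p X) (p Y)" for X Y
    using assms(2) by (auto simp: p_def)
  show ?thesis
    unfolding linear_bf_def
  proof (intro conjI allI impI)
    fix X assume "X \<subseteq> E"
    then show "h X \<in> {0, 1}"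
      using p[of X] assms(1) unfolding linear_bf_def by metis
  next
    fix X Y assume XY: "X \<subseteq> E" "Y \<subseteq> E" "h X = 1 \<and> h Y = 1"
    then have "h (symdiff (p X) (p Y)) = 1"
      using p[of X] p[of Y] assms(1) unfolding linear_bf_def by metis
    moreover have "symdiff X Y \<subseteq> E" using XY by blast
    ultimately show "h (symdiff X Y) = 1"
      using p(2)[of "symdiff X Y"] sd[of X Y] by simp
  qed
qed


text \<open>If \<open>h {e}\<close> were nonzero, \<open>e\<close> would double the sum over the
  empty set, hence over every subset of \<open>E - {e}\<close>. Moebius inversion then gives
  \<open>h (insert e A) = h A\<close>, a pullback.\<close>

lemma nonlinear_no_loop:
  assumes N: "nullity_like E h" and e: "e \<in> E"
    and lin: "linear_bf (E - {e}) h" and nonlin: "\<not> linear_bf E h"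
  shows "h {e} = 0"
proof (rule ccontr)
  assume nz: "h {e} \<noteq> 0"
  have fin: "finite E" and h0: "h {} = 1"
    using nullity_likeD[OF N] by simp_all
  have "psum h (insert e {}) \<in> {psum h {}, 2 * psum h {}}"
    using e by (intro nullity_likeD(3)[OF N]) auto
  then have double: "psum h (insert e {}) = 2 * psum h {}"
    using nz h0 by auto
  have "h (insert e A) = h A" if A: "A \<subseteq> E - {e}" for A
  proof (rule psum_determines)
    show "finite A" using A fin finite_subset by blast
    fix V assume V: "V \<subseteq> A"
    have "psum h (insert e V) = 2 * psum h V"
      using psum_double_mono[OF N _ _ _ double, of V] V A e by auto
    moreover have "finite V" "e \<notin> V"
      using V A fin by (auto intro: finite_subset)
    ultimately show "psum (\<lambda>A. h (insert e A)) V = psum h V"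
      using psum_insert[of V e h] by simp
  qed
  then have "linear_bf E h"
    using linear_bf_pullback[OF lin, of "{}"] by simp
  then show False using nonlin by simp
qed

text \<open>With zero singletons, nonzero \<open>h {a, b}\<close> makes \<open>a\<close> double the
  sum over \<open>{b}\<close> and \<open>b\<close> that over \<open>{a}\<close>. Both persist over
  larger sets, so \<open>a\<close> and \<open>b\<close> become interchangeable and adding both
  changes no value.\<close>

lemma nonlinear_no_parallel:
  assumes N: "nullity_like E h" and ab: "a \<in> E" "b \<in> E" "a \<noteq> b"
    and loopless: "h {a} = 0" "h {b} = 0"
    and lin: "linear_bf (E - {b}) h" and nonlin: "\<not> linear_bf E h"
  shows "h {a, b} = 0"
proof (rule ccontr)
  assume nz: "h {a, b} \<noteq> 0"
  have fin: "finite E" and h0: "h {} = 1"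
    using nullity_likeD[OF N] by simp_all
  have ab': "psum h {a, b} = 1 + h {a, b}"
    using psum_insert[of "{b}" a h] ab loopless h0 by simp
  have "psum h (insert a {b}) \<in> {psum h {b}, 2 * psum h {b}}"
    using ab by (intro nullity_likeD(3)[OF N]) auto
  then have d1: "psum h (insert a {b}) = 2 * psum h {b}"
    using nz h0 ab' loopless by auto
  then have d2: "psum h (insert b {a}) = 2 * psum h {a}"
    using h0 loopless by (simp add: insert_commute)
  have sums: "psum (\<lambda>A. h (insert a A)) V = psum (\<lambda>A. h (insert b A)) V"
    "psum (\<lambda>A. h (insert a (insert b A))) V = psum h V" if V: "V \<subseteq> E - {a, b}" for V
  proof -
    have finV: "finite V" "a \<notin> V" "b \<notin> V"
      using V fin by (auto intro: finite_subset)
    have 1: "psum h (insert a (insert b V)) = 2 * psum h (insert b V)"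
      using psum_double_mono[OF N _ _ _ d1, of "insert b V"] V ab by auto
    have 2: "psum h (insert b (insert a V)) = 2 * psum h (insert a V)"
      using psum_double_mono[OF N _ _ _ d2, of "insert a V"] V ab by auto
    have 3: "psum h (insert a V) = psum h (insert b V)"
      using 1 2 by (simp add: insert_commute)
    then show "psum (\<lambda>A. h (insert a A)) V = psum (\<lambda>A. h (insert b A)) V"
      using finV by (simp add: psum_insert)
    \<comment> \<open>The sum over \<open>V\<close> with \<open>a\<close> and \<open>b\<close> added
      splits into four parts; the two mixed ones are equal and cancel from the doubling
      equation.\<close>
    then show "psum (\<lambda>A. h (insert a (insert b A))) V = psum h V"
      using 1 finV ab by (simp add: psum_insert)
  qed
  have vals: "h (insert a A) = h (insert b A)" "h (insert a (insert b A)) = h A"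
    if A: "A \<subseteq> E - {a, b}" for A
  proof -
    have "finite A" using A fin finite_subset by blast
    then show "h (insert a A) = h (insert b A)" "h (insert a (insert b A)) = h A"
      using A sums psum_determines[of A "\<lambda>A. h (insert a A)" "\<lambda>A. h (insert b A)"]
        psum_determines[of A "\<lambda>A. h (insert a (insert b A))" h]
      by (meson subset_trans)+
  qed
  have "linear_bf E h"
  proof (rule linear_bf_pullback[OF lin, of "{a}"])
    show "{a} \<subseteq> E - {b}" using ab by blast
    fix A assume A: "A \<subseteq> E - {b}"
    show "h (insert b A) = h (symdiff A {a})"
    proof (cases "a \<in> A")
      case True
      then have "insert b A = insert a (insert b (A - {a}))" "symdiff A {a} = A - {a}"
        by auto
      then show ?thesis using vals(2)[of "A - {a}"] A by auto
    next
      case False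
      then have "symdiff A {a} = insert a A" by auto
      moreover have "A \<subseteq> E - {a, b}" using A False by blast
      ultimately show ?thesis using vals(1)[of A] by simp
    qed
  qed
  then show False using nonlin by simp
qed

section \<open>Minors\<close>

text \<open>Contraction only shrinks the ground set, so the values of a minor depend on the deleted set alone.\<close>

definition minor_fun :: "('a set \<Rightarrow> real) \<Rightarrow> 'a set \<Rightarrow> 'a set \<Rightarrow> real" where
  "minor_fun f Y A = psum (\<lambda>Z. f (A \<union> Z)) Y / psum f Y"

lemma minor_fun_empty [simp]: "f {} = 1 \<Longrightarrow> minor_fun f {} = f"
  by (simp add: minor_fun_def fun_eq_iff)

text \<open>The factor \<open>psum f Y\<close> cancels, so deletions can be treated one element at a
  time.\<close>

lemma minor_fun_insert:
  assumes "finite Y" "e \<notin> Y" "psum f Y \<noteq> 0"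
  shows "minor_fun f (insert e Y) =
    (\<lambda>A. (minor_fun f Y A + minor_fun f Y (insert e A)) / (1 + minor_fun f Y {e}))"
proof
  fix A
  have "1 + minor_fun f Y {e} = psum f (insert e Y) / psum f Y"
    using assms by (simp add: minor_fun_def psum_insert field_simps)
  moreover have "minor_fun f Y A + minor_fun f Y (insert e A)
      = psum (\<lambda>Z. f (A \<union> Z)) (insert e Y) / psum f Y"
    using assms by (simp add: minor_fun_def psum_insert add_divide_distrib)
  ultimately show "minor_fun f (insert e Y) A =
      (minor_fun f Y A + minor_fun f Y (insert e A)) / (1 + minor_fun f Y {e})"
    using assms by (simp add: minor_fun_def)
qed

lemma psum_minor_fun:
  assumes "finite W" "finite Y" "W \<inter> Y = {}"
  shows "psum (minor_fun f Y) W = psum f (W \<union> Y) / psum f Y"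
proof -
  \<comment> \<open>Clearing the denominator lets \<open>f\<close> vary: the induction hypothesis is
    also needed for \<open>\<lambda>A. f (insert e A)\<close>.\<close>
  have "psum f (W \<union> Y) = (\<Sum>A\<in>Pow W. psum (\<lambda>Z. f (A \<union> Z)) Y)"
    using assms(1,3)
  proof (induction W arbitrary: f rule: finite_induct)
    case empty
    then show ?case by simp
  next
    case (insert e W)
    have inj: "inj_on (insert e) (Pow W)" "Pow W \<inter> insert e ` Pow W = {}"
      using insert(2) by (auto simp: inj_on_def)
    have "psum f (insert e W \<union> Y) = psum f (W \<union> Y) + psum (\<lambda>A. f (insert e A)) (W \<union> Y)"
      using insert assms(2) by (simp add: psum_insert)
    also have "\<dots> = (\<Sum>A\<in>Pow W. psum (\<lambda>Z. f (A \<union> Z)) Y)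
        + (\<Sum>A\<in>Pow W. psum (\<lambda>Z. f (insert e (A \<union> Z))) Y)"
      using insert by simp
    finally show ?case
      using insert inj by (simp add: Pow_insert sum.union_disjoint sum.reindex)
  qed
  then show ?thesis
    by (simp add: minor_fun_def psum_def sum_divide_distrib)
qed

text \<open>Sums of the minor over \<open>W\<close> are sums of \<open>f\<close> over
  \<open>W \<union> Y\<close> divided by a positive constant, so both conditions at \<open>W\<close>
  are those of \<open>f\<close> at \<open>W \<union> Y\<close>.\<close>

lemma nullity_like_minor_fun:
  assumes N: "nullity_like E f" and Y: "Y \<subseteq> E"
  shows "nullity_like (E - Y) (minor_fun f Y)"
proof -
  have fin: "finite E" and finY: "finite Y"
    using nullity_likeD(1)[OF N] Y finite_subset by auto
  have nz: "psum f Y > 0"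
    using psum_pos[OF N Y] .
  have eq: "psum (minor_fun f Y) W = psum f (W \<union> Y) / psum f Y" if "W \<subseteq> E - Y" for W
    using that fin finY by (intro psum_minor_fun) (auto intro: finite_subset)
  show ?thesis
    unfolding nullity_like_def
  proof (intro conjI allI ballI impI)
    show "finite (E - Y)" using fin by simp
    show "minor_fun f Y {} = 1" using nz by (simp add: minor_fun_def)
  next
    fix W e assume W: "W \<subseteq> E - Y" "e \<in> E - Y - W"
    then have "psum f (insert e (W \<union> Y)) \<in> {psum f (W \<union> Y), 2 * psum f (W \<union> Y)}"
      using Y by (intro nullity_likeD(3)[OF N]) auto
    then show "psum (minor_fun f Y) (insert e W)
        \<in> {psum (minor_fun f Y) W, 2 * psum (minor_fun f Y) W}"
      using W by (auto simp: eq)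
  next
    fix W a b
    assume W: "W \<subseteq> E - Y" "a \<in> E - Y - W" "b \<in> E - Y - W" "a \<noteq> b"
      and d: "psum (minor_fun f Y) (insert a W) = 2 * psum (minor_fun f Y) W"
    have "psum f (insert a (W \<union> Y)) = 2 * psum f (W \<union> Y)"
      using d W nz by (simp add: eq)
    then have "psum f (insert a (insert b (W \<union> Y))) = 2 * psum f (insert b (W \<union> Y))"
      using Y W by (intro nullity_likeD(4)[OF N]) auto
    then show "psum (minor_fun f Y) (insert a (insert b W))
        = 2 * psum (minor_fun f Y) (insert b W)"
      using W by (simp add: eq)
  qed
qed

section \<open>Linearity under contraction and deletion\<close>

lemma linear_bf_subset: "linear_bf E f \<Longrightarrow> D \<subseteq> E \<Longrightarrow> linear_bf D f"
  unfolding linear_bf_def by (meson subset_trans)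

lemma linear_bf_cong:
  assumes "\<And>A. A \<subseteq> E \<Longrightarrow> f A = g A"
  shows "linear_bf E f \<longleftrightarrow> linear_bf E g"
proof -
  have "linear_bf E k" if "linear_bf E h" and eq: "\<And>A. A \<subseteq> E \<Longrightarrow> h A = k A" for h k
    unfolding linear_bf_def
  proof (intro conjI allI impI)
    fix X assume "X \<subseteq> E"
    then show "k X \<in> {0, 1}"
      using that unfolding linear_bf_def by metis
  next
    fix X Y assume XY: "X \<subseteq> E" "Y \<subseteq> E" "k X = 1 \<and> k Y = 1"
    then have "h (symdiff X Y) = 1"
      using that unfolding linear_bf_def by simp
    moreover have "symdiff X Y \<subseteq> E" using XY by blast
    ultimately show "k (symdiff X Y) = 1" using eq by simp
  qed
  then show ?thesis using assms by metis
qed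

text \<open>The deletion is the indicator of the sets of value 1 with \<open>e\<close> removed. If
  \<open>h {e} = 1\<close>, both or neither of \<open>A\<close> and \<open>insert e A\<close> have
  value 1; otherwise at most one does. Dividing by \<open>1 + h {e}\<close> thus gives 0 or
  1.\<close>

lemma linear_bf_delete_element:
  assumes lin: "linear_bf E h" and "e \<in> E"
  shows "linear_bf (E - {e}) (\<lambda>A. (h A + h (insert e A)) / (1 + h {e}))"
proof -
  have v: "h X = 0 \<or> h X = 1" if "X \<subseteq> E" for X
    using lin that unfolding linear_bf_def by blast
  have c: "h (symdiff X Y) = 1" if "X \<subseteq> E" "Y \<subseteq> E" "h X = 1" "h Y = 1" for X Y
    using lin that unfolding linear_bf_def by blast
  have t: "symdiff A (insert e A) = {e}" "symdiff A {e} = insert e A"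
    "symdiff (insert e A) {e} = A" if "A \<subseteq> E - {e}" for A
    using that by auto
  have s: "symdiff (insert e A) B = insert e (symdiff A B)"
    "symdiff A (insert e B) = insert e (symdiff A B)"
    "symdiff (insert e A) (insert e B) = symdiff A B"
    if "A \<subseteq> E - {e}" "B \<subseteq> E - {e}" for A B
    using that by auto
  show ?thesis
  proof (cases "h {e} = 1")
    case True
    have "h (insert e A) = h A" if A: "A \<subseteq> E - {e}" for A
      using c[of A "{e}"] c[of "insert e A" "{e}"] t[OF A] A True assms(2)
        v[of A] v[of "insert e A"] by fastforce
    then have eq: "(h A + h (insert e A)) / (1 + h {e}) = h A" if "A \<subseteq> E - {e}" for A
      using that True by simp
    have "linear_bf (E - {e}) h" by (rule linear_bf_subset[OF lin]) blast
    then show ?thesis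
      using linear_bf_cong[of "E - {e}", OF eq] by simp
  next
    case False
    then have e0: "h {e} = 0" using v[of "{e}"] assms(2) by blast
    have alt: "\<not> (h A = 1 \<and> h (insert e A) = 1)" if A: "A \<subseteq> E - {e}" for A
      using c[of A "insert e A"] t(1)[OF A] A False assms(2) by fastforce
    have sub: "A \<subseteq> E" "insert e A \<subseteq> E" if "A \<subseteq> E - {e}" for A
      using that assms(2) by auto
    have one: "h A + h (insert e A) = 1 \<longleftrightarrow> h A = 1 \<or> h (insert e A) = 1"
      if A: "A \<subseteq> E - {e}" for A
      using alt[OF A] v[OF sub(1)[OF A]] v[OF sub(2)[OF A]] by auto
    show ?thesis
      unfolding linear_bf_def e0
    proof (intro conjI allI impI)
      fix A assume A: "A \<subseteq> E - {e}"
      show "(h A + h (insert e A)) / (1 + 0) \<in> {0, 1}"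
        using alt[OF A] v[OF sub(1)[OF A]] v[OF sub(2)[OF A]] by auto
    next
      fix A B assume A: "A \<subseteq> E - {e}" and B: "B \<subseteq> E - {e}"
        and AB: "(h A + h (insert e A)) / (1 + 0) = 1 \<and> (h B + h (insert e B)) / (1 + 0) = 1"
      have AB': "h A = 1 \<or> h (insert e A) = 1" "h B = 1 \<or> h (insert e B) = 1"
        using AB one[OF A] one[OF B] by simp_all
      have "h (symdiff A B) = 1 \<or> h (insert e (symdiff A B)) = 1"
        using AB' c[OF sub(1)[OF A] sub(1)[OF B]] c[OF sub(1)[OF A] sub(2)[OF B]]
          c[OF sub(2)[OF A] sub(1)[OF B]] c[OF sub(2)[OF A] sub(2)[OF B]] s[OF A B]
        by metis
      moreover have "symdiff A B \<subseteq> E - {e}" using A B by blast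
      ultimately show "(h (symdiff A B) + h (insert e (symdiff A B))) / (1 + 0) = 1"
        using one[of "symdiff A B"] by simp
    qed
  qed
qed


section \<open>Minimal nonlinear functions\<close>

text \<open>Minimality is tested on single-element minors: \<open>lin\<close> concerns contractions,
  \<open>lin_del\<close> deletions.\<close>

locale minimal_nonlinear =
  fixes E :: "'a set" and h :: "'a set \<Rightarrow> real"
  assumes nullity: "nullity_like E h"
    and lin: "\<And>e. e \<in> E \<Longrightarrow> linear_bf (E - {e}) h"
    and lin_del: "\<And>e. e \<in> E \<Longrightarrow> linear_bf (E - {e}) (\<lambda>A. (h A + h (insert e A)) / (1 + h {e}))"
    and nonlin: "\<not> linear_bf E h"
begin

lemmas empty_val = nullity_likeD(2)[OF nullity]

lemma singleton_val: "e \<in> E \<Longrightarrow> h {e} = 0"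
  using nonlinear_no_loop[OF nullity _ lin nonlin] .

lemma pair_val: "a \<in> E \<Longrightarrow> b \<in> E \<Longrightarrow> a \<noteq> b \<Longrightarrow> h {a, b} = 0"
  using nonlinear_no_parallel[OF nullity _ _ _ singleton_val singleton_val lin nonlin] .

lemma proper_val: "A \<subset> E \<Longrightarrow> h A = 0 \<or> h A = 1"
proof -
  assume "A \<subset> E"
  then obtain e where "e \<in> E" "A \<subseteq> E - {e}" by blast
  then show ?thesis using lin[of e] unfolding linear_bf_def by blast
qed

text \<open>An element outside \<open>A \<union> B\<close> can be contracted, leaving both sets in a
  linear minor. Naming the result \<open>C\<close> lets it be given in simplified form.\<close>

lemma proper_closed:
  assumes "A \<union> B \<subset> E" "h A = 1" "h B = 1" "C = symdiff A B"
  shows "h C = 1"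
proof -
  obtain e where "e \<in> E" "A \<subseteq> E - {e}" "B \<subseteq> E - {e}" using assms(1) by blast
  then show ?thesis using lin[of e] assms unfolding linear_bf_def by blast
qed

text \<open>Singletons vanish, so the denominator of the deletion is 1.\<close>

lemma del_val: "e \<in> E \<Longrightarrow> A \<subseteq> E - {e} \<Longrightarrow> h A + h (insert e A) \<in> {0, 1}"
  using lin_del[of e] singleton_val[of e] unfolding linear_bf_def by simp

lemma del_closed:
  assumes "e \<in> E" "A \<subseteq> E - {e}" "B \<subseteq> E - {e}" "h A + h (insert e A) = 1"
    "h B + h (insert e B) = 1" "C = symdiff A B"
  shows "h C + h (insert e C) = 1"
  using lin_del[of e] singleton_val[of e] assms unfolding linear_bf_def by simp

lemma nonempty: "E \<noteq> {}"
  using nonlin empty_val by (auto simp: linear_bf_def)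

section \<open>The value on the whole ground set\<close>

lemma top_val_cases: "h E \<in> {-1, 0, 1}"
proof -
  obtain e where e: "e \<in> E" using nonempty by blast
  then have "h (E - {e}) + h E \<in> {0, 1}"
    using del_val[of e "E - {e}"] by (simp add: insert_absorb)
  moreover have "h (E - {e}) = 0 \<or> h (E - {e}) = 1"
    using e by (intro proper_val) blast
  ultimately show ?thesis by auto
qed

text \<open>Otherwise all values are 0 or 1, and some \<open>X\<close>, \<open>Y\<close> of value 1
  have a symmetric difference \<open>Z\<close> of value 0; they must cover \<open>E\<close>. If
  \<open>X \<inter> Y\<close> has at most one element, a singleton or pair gets value 1. A larger
  intersection does the same or leaves four elements with an impossible total.\<close>

lemma top_val: "h E = -1"
proof (rule ccontr)
  assume "h E \<noteq> -1"
  then have val: "h A = 0 \<or> h A = 1" if "A \<subseteq> E" for A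
    using that top_val_cases proper_val[of A] by (cases "A = E") auto
  have one: "h A + h (insert e A) = 1"
    if "e \<in> E" "A \<subseteq> E - {e}" "h A = 1 \<or> h (insert e A) = 1" for e A
  proof -
    have "A \<subseteq> E" "insert e A \<subseteq> E" using that by auto
    then show ?thesis
      using val[of A] val[of "insert e A"] del_val[OF that(1,2)] that(3) by auto
  qed
  have "h (symdiff X Y) = 1" if XY: "X \<subseteq> E" "Y \<subseteq> E" "h X = 1" "h Y = 1" for X Y
  proof (rule ccontr)
    define Z where "Z = symdiff X Y"
    assume "h (symdiff X Y) \<noteq> 1"
    then have Z0: "h Z = 0" and ZE: "Z \<subseteq> E"
      using val[of "symdiff X Y"] XY unfolding Z_def by auto
    have Zne: "Z \<noteq> {}" using Z0 empty_val by auto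
    have un: "X \<union> Y = E"
    proof (rule ccontr)
      assume "X \<union> Y \<noteq> E"
      then have "X \<union> Y \<subset> E" using XY by blast
      then have "h Z = 1" using XY(3,4) Z_def by (rule proper_closed)
      then show False using Z0 by simp
    qed
    show False
    proof (cases "X \<inter> Y = {}")
      case True
      then have "Z = E" using un Z_def by blast
      have "Y \<noteq> {}" "X \<noteq> {}" using Z0 XY Z_def by auto
      then obtain y where y: "y \<in> Y" by blast
      \<comment> \<open>Deleting \<open>y\<close> turns \<open>Y\<close> into
        \<open>Y - {y}\<close>, whose symmetric difference with \<open>X\<close> is
        \<open>E - {y}\<close>. As \<open>h E = 0\<close>, the value 1 falls on
        \<open>E - {y}\<close>.\<close>
      have "h (E - {y}) + h (insert y (E - {y})) = 1"
      proof (rule del_closed[of y X "Y - {y}"])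
        show "h X + h (insert y X) = 1"
          using XY y True by (intro one) auto
        show "h (Y - {y}) + h (insert y (Y - {y})) = 1"
          using XY y by (intro one) (auto simp: insert_absorb)
      qed (use XY y True un in auto)
      moreover have "insert y (E - {y}) = E" using y XY by blast
      ultimately have "h (E - {y}) = 1"
        using Z0 \<open>Z = E\<close> by simp
      moreover have "X \<union> (E - {y}) \<subset> E" "Y - {y} = symdiff X (E - {y})"
        using y un True by blast+
      ultimately have "h (Y - {y}) = 1"
        using XY(3) proper_closed by blast
      moreover have "Y \<union> (Y - {y}) \<subset> E" "{y} = symdiff Y (Y - {y})"
        using y un True \<open>X \<noteq> {}\<close> by blast+
      ultimately have "h {y} = 1"
        using XY(4) proper_closed by blast
      then show False using singleton_val[of y] y XY by auto
    next
      case False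
      then obtain e where e: "e \<in> X" "e \<in> Y" by blast
      \<comment> \<open>Deleting a common element \<open>x\<close> keeps \<open>Z\<close> as the
        symmetric difference, and \<open>Z\<close> itself has value 0.\<close>
      have Ze: "h (insert x Z) = 1" if x: "x \<in> X" "x \<in> Y" for x
      proof -
        have "h Z + h (insert x Z) = 1"
        proof (rule del_closed[of x "X - {x}" "Y - {x}"])
          show "h (X - {x}) + h (insert x (X - {x})) = 1"
            using XY x by (intro one) (auto simp: insert_absorb)
          show "h (Y - {x}) + h (insert x (Y - {x})) = 1"
            using XY x by (intro one) (auto simp: insert_absorb)
        qed (use XY x Z_def in auto)
        then show ?thesis using Z0 by simp
      qed
      show False
      proof (cases "X \<inter> Y = {e}")
        case True
        have "insert e Z = E" using True un unfolding Z_def by blast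
        then have E1: "h E = 1" using Ze[OF e] by simp
        \<comment> \<open>Stated for \<open>P\<close> and \<open>R\<close> because \<open>z\<close>
          may lie in either \<open>X\<close> or \<open>Y\<close>.\<close>
        have contra: False
          if P: "P \<union> R = E" "P \<inter> R = {e}" "h P = 1" "h R = 1" "z \<in> P - R" for P R z
        proof -
          have PE: "P \<subset> E"
          proof -
            have "P \<noteq> E"
            proof
              assume "P = E"
              then have "R = {e}" using P by blast
              then show False using singleton_val[of e] P by auto
            qed
            then show ?thesis using P by blast
          qed
          have ez: "e \<in> P" "z \<in> P" "e \<noteq> z" "z \<in> E" "e \<in> E" using P by auto
          \<comment> \<open>After deleting \<open>z\<close>, the symmetric difference of
            \<open>E\<close> and \<open>R\<close> is \<open>P - {e} - {z}\<close>. Value 1 there or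
            at \<open>P - {e}\<close> combines with \<open>P\<close> into \<open>{e, z}\<close> or
            \<open>{e}\<close>.\<close>
          have "h (P - {e} - {z}) + h (insert z (P - {e} - {z})) = 1"
          proof (rule del_closed[of z "E - {z}" R])
            have "insert z (E - {z}) = E" using ez by blast
            then show "h (E - {z}) + h (insert z (E - {z})) = 1"
              using E1 ez by (intro one) auto
            show "h R + h (insert z R) = 1"
              using P ez by (intro one) auto
          qed (use P ez in auto)
          moreover have "insert z (P - {e} - {z}) = P - {e}" using ez by blast
          moreover have "h (P - {e}) \<noteq> 1"
          proof
            assume "h (P - {e}) = 1"
            moreover have "P \<union> (P - {e}) \<subset> E" "{e} = symdiff P (P - {e})"
              using PE ez by blast+
            ultimately have "h {e} = 1"
              using P(3) proper_closed by blast
            then show False using singleton_val[of e] ez by simp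
          qed
          moreover have "h (P - {e}) = 0 \<or> h (P - {e}) = 1"
            using PE by (intro val) auto
          ultimately have "h (P - {e} - {z}) = 1" by auto
          moreover have "P \<union> (P - {e} - {z}) \<subset> E" "{e, z} = symdiff P (P - {e} - {z})"
            using PE ez by blast+
          ultimately have "h {e, z} = 1"
            using P(3) proper_closed by blast
          then show False using pair_val[of e z] ez by auto
        qed
        obtain z where "z \<in> Z" using Zne by blast
        then consider "z \<in> X - Y" | "z \<in> Y - X" unfolding Z_def by blast
        then show False
        proof cases
          case 1
          then show False using contra[OF un True XY(3,4)] by simp
        next
          case 2
          have "Y \<union> X = E" "Y \<inter> X = {e}" using un True by auto
          then show False using contra[OF _ _ XY(4,3) 2] by simp
        qed
      next
        case False
        then obtain e' where e': "e' \<in> X" "e' \<in> Y" "e' \<noteq> e" using e by blast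
        have ee: "h {e, e'} = 0" using pair_val[of e e'] e e' XY by auto
        \<comment> \<open>A third common element lies outside \<open>insert e Z\<close> and
          \<open>insert e' Z\<close>, whose symmetric difference is the pair
          \<open>{e, e'}\<close>.\<close>
        have XY2: "X \<inter> Y = {e, e'}"
        proof (rule ccontr)
          assume "X \<inter> Y \<noteq> {e, e'}"
          then obtain x where "x \<in> X" "x \<in> Y" "x \<noteq> e" "x \<noteq> e'" using e e' by blast
          then have "insert e Z \<union> insert e' Z \<subset> E"
            using XY e e' unfolding Z_def by blast
          then have "h {e, e'} = 1"
            using Ze[OF e] Ze[OF e'(1,2)] by (rule proper_closed) (use e e' in \<open>auto simp: Z_def\<close>)
          then show False using ee by simp
        qed
        \<comment> \<open>With \<open>z\<close> deleted, \<open>insert e Z\<close> and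
          \<open>insert e' Z\<close> still have symmetric difference \<open>{e, e'}\<close>; the
          pair has value 0, so the triple takes the 1.\<close>
        have zee: "h {z, e, e'} = 1" if z: "z \<in> Z" for z
        proof -
          have zne: "z \<noteq> e" "z \<noteq> e'" "z \<in> E" using z e e' ZE by (auto simp: Z_def)
          have eqs: "insert z (insert e (Z - {z})) = insert e Z"
            "insert z (insert e' (Z - {z})) = insert e' Z" using z by auto
          have "h {e, e'} + h (insert z {e, e'}) = 1"
          proof (rule del_closed[of z "insert e (Z - {z})" "insert e' (Z - {z})"])
            show "h (insert e (Z - {z})) + h (insert z (insert e (Z - {z}))) = 1"
              using zne e XY ZE by (intro one) (auto simp: eqs Ze)
            show "h (insert e' (Z - {z})) + h (insert z (insert e' (Z - {z}))) = 1"
              using zne e' XY ZE by (intro one) (auto simp: eqs Ze)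
          qed (use zne e e' XY ZE in \<open>auto simp: Z_def\<close>)
          then show ?thesis using ee by simp
        qed
        obtain z where z: "z \<in> Z" using Zne by blast
        \<comment> \<open>Otherwise one of \<open>X\<close>, \<open>Y\<close> contains the other,
          and the smaller is the pair \<open>{e, e'}\<close>.\<close>
        have "Z \<noteq> {z}"
        proof
          assume "Z = {z}"
          then have sub: "X - Y \<subseteq> {z}" "Y - X \<subseteq> {z}" unfolding Z_def by blast+
          have "X \<subseteq> Y \<or> Y \<subseteq> X"
          proof (cases "z \<in> X")
            case True
            then show ?thesis using sub(2) by blast
          next
            case False
            then show ?thesis using sub(1) by blast
          qed
          then have "X = {e, e'} \<or> Y = {e, e'}"
            using XY2 by (metis Int_absorb1 Int_absorb2)
          then show False using ee XY by auto
        qed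
        then obtain z' where z': "z' \<in> Z" "z' \<noteq> z" using z by blast
        have eZ: "e \<notin> Z" "e' \<notin> Z"
          using e e' by (simp_all add: Z_def)
        have dist: "z \<noteq> e" "z \<noteq> e'" "z' \<noteq> e" "z' \<noteq> e'" "e \<in> E" "e' \<in> E" "z \<in> E" "z' \<in> E"
          using z z' eZ e(1) e'(1) ZE XY(1) by auto
        have E4: "E = {e, e', z, z'}"
        proof (rule ccontr)
          assume "E \<noteq> {e, e', z, z'}"
          then have "{z, e, e'} \<union> {z', e, e'} \<subset> E" using dist by blast
          then have "h {z, z'} = 1"
            using zee[OF z] zee[OF z'(1)] by (rule proper_closed) (use dist z' in auto)
          then show False using pair_val[of z z'] dist z' by simp
        qed
        have Z2: "Z = {z, z'}"
          using E4 XY2 z z' ZE dist by (auto simp: Z_def)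
        have triples: "h {e, z, z'} = 1" "h {e', z, z'} = 1" "h {e, e', z} = 1" "h {e, e', z'} = 1"
          using Ze[of e] Ze[of e'] e e' zee[OF z] zee[OF z'(1)]
          by (simp_all add: Z2 insert_commute)
        have pairs: "h {e, z} = 0" "h {e, z'} = 0" "h {e', z} = 0" "h {e', z'} = 0" "h {z, z'} = 0"
          using pair_val dist z' by simp_all
        \<comment> \<open>All four triples have value 1, so the sum over \<open>Pow E\<close> can only be 2 or 4 if \<open>h E\<close> is negative.\<close>
        have S3: "psum h {e', z, z'} = 2"
          using dist z' e' triples pairs singleton_val empty_val by (simp add: psum_insert)
        have S4: "psum h {e, e', z, z'} = 5 + h {e, e', z, z'}"
          using dist z' e' triples pairs ee singleton_val empty_val by (simp add: psum_insert)
        have "psum h (insert e {e', z, z'}) \<in> {psum h {e', z, z'}, 2 * psum h {e', z, z'}}"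
          using dist e' by (intro nullity_likeD(3)[OF nullity]) auto
        then show False
          using S3 S4 val[of "{e, e', z, z'}"] dist by auto
      qed
    qed
  qed
  then have "linear_bf E h"
    using val unfolding linear_bf_def by blast
  then show False using nonlin by simp
qed

section \<open>Hyperplanes, triples and the size of the ground set\<close>

text \<open>Deletion values are nonnegative, so \<open>h E = -1\<close> must be offset by 1.\<close>

lemma hyperplane_val:
  assumes "e \<in> E"
  shows "h (E - {e}) = 1"
proof -
  have "h (E - {e}) = 0 \<or> h (E - {e}) = 1"
    using assms by (intro proper_val) blast
  then show ?thesis
    using del_val[of e "E - {e}"] top_val assms by (auto simp: insert_absorb)
qed

text \<open>With \<open>c\<close> deleted, the hyperplanes missing \<open>a\<close> and
  \<open>b\<close> have symmetric difference \<open>{a, b}\<close>. The pair has value 0, so adding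
  \<open>c\<close> gives 1.\<close>

lemma triple_val:
  assumes "a \<in> E" "b \<in> E" "c \<in> E" "a \<noteq> b" "a \<noteq> c" "b \<noteq> c"
  shows "h {a, b, c} = 1"
proof -
  have sum1: "h (E - {x} - {c}) + h (insert c (E - {x} - {c})) = 1" if "x \<in> E" "x \<noteq> c" for x
  proof -
    have "insert c (E - {x} - {c}) = E - {x}" using assms that by blast
    then have "h (insert c (E - {x} - {c})) = 1"
      using hyperplane_val[OF that(1)] by simp
    moreover have "h (E - {x} - {c}) = 0 \<or> h (E - {x} - {c}) = 1"
      using that by (intro proper_val) blast
    moreover have "h (E - {x} - {c}) + h (insert c (E - {x} - {c})) \<in> {0, 1}"
      using assms(3) by (intro del_val) auto
    ultimately show ?thesis by auto
  qed
  have "h {a, b} + h (insert c {a, b}) = 1"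
    by (rule del_closed[of c "E - {a} - {c}" "E - {b} - {c}"])
      (use assms sum1 in auto)
  then show ?thesis
    using pair_val assms by (simp add: insert_commute)
qed

text \<open>The value -1 occurs on no set of at most three elements. A fifth element would let
  \<open>{a, b, c}\<close> and \<open>{a, b, d}\<close> combine into the pair
  \<open>{c, d}\<close>.\<close>

lemma card_ground: "card E = 4"
proof -
  obtain a where a: "a \<in> E" using nonempty by blast
  have "E \<noteq> {a}" using singleton_val[OF a] top_val by auto
  then obtain b where b: "b \<in> E" "b \<noteq> a" using a by blast
  have "E \<noteq> {a, b}" using pair_val[of a b] a b top_val by auto
  then obtain c where c: "c \<in> E" "c \<noteq> a" "c \<noteq> b" using a b by blast
  have "E \<noteq> {a, b, c}" using triple_val[of a b c] a b c top_val by auto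
  then obtain d where d: "d \<in> E" "d \<noteq> a" "d \<noteq> b" "d \<noteq> c" using a b c by blast
  have "E = {a, b, c, d}"
  proof (rule ccontr)
    assume "E \<noteq> {a, b, c, d}"
    then have "{a, b, c} \<union> {a, b, d} \<subset> E" using a b c d by blast
    moreover have "h {a, b, c} = 1" "h {a, b, d} = 1"
      using triple_val a b c d by simp_all
    ultimately have "h {c, d} = 1"
      by (rule proper_closed) (use c d in auto)
    then show False using pair_val[of c d] c d by simp
  qed
  then show ?thesis using b c d by simp
qed

text \<open>The values of \<open>h\<close> depend only on cardinality, so any bijection
  serves.\<close>

lemma isomorphic_U24: "isomorphic_bf E h E_U24 f_U24"
proof -
  have fin: "finite E" using nullity_likeD(1)[OF nullity] .
  have "finite E_U24" "card E = card E_U24" by (simp_all add: E_U24_def card_ground)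
  then obtain \<phi> where \<phi>: "bij_betw \<phi> E E_U24"
    using fin finite_same_card_bij by blast
  have "h X = f_U24 (\<phi> ` X)" if X: "X \<subseteq> E" for X
  proof -
    have cX: "card (\<phi> ` X) = card X"
      using \<phi> X by (meson bij_betw_def card_image inj_on_subset)
    have "card X \<le> 4" using card_mono[OF fin X] card_ground by simp
    then consider "card X = 0" | "card X = 1" | "card X = 2" | "card X = 3" | "card X = 4"
      by linarith
    then show ?thesis
    proof cases
      case 1
      then have "X = {}" using finite_subset[OF X fin] by simp
      then show ?thesis using empty_val by (simp add: f_U24_def)
    next
      case 2
      then obtain a where "X = {a}" by (rule card_1_singletonE)
      then show ?thesis using X singleton_val[of a] by (simp add: f_U24_def)
    next
      case 3
      then obtain a b where "X = {a, b}" "a \<noteq> b" by (auto simp: card_2_iff)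
      then show ?thesis using X pair_val[of a b] cX 3 by (simp add: f_U24_def)
    next
      case 4
      then obtain a b c where "X = {a, b, c}" "a \<noteq> b" "a \<noteq> c" "b \<noteq> c"
        by (auto simp: card_3_iff)
      then show ?thesis using X triple_val[of a b c] cX 4 by (simp add: f_U24_def)
    next
      case 5
      then have "X = E" using card_subset_eq[OF fin X] card_ground by simp
      then show ?thesis using top_val cX 5 by (simp add: f_U24_def)
    qed
  qed
  then show ?thesis using \<phi> unfolding isomorphic_bf_def by blast
qed

end

section \<open>The excluded minor theorem\<close>

lemma linear_bf_minor_fun:
  assumes N: "nullity_like E f" and lin: "linear_bf E f" and Y: "Y \<subseteq> E"
  shows "linear_bf (E - Y) (minor_fun f Y)"
proof -
  have "finite Y" using nullity_likeD(1)[OF N] Y finite_subset by blast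
  then show ?thesis
    using Y
  proof (induction Y rule: finite_induct)
    case empty
    then show ?case using lin nullity_likeD(2)[OF N] by simp
  next
    case (insert e Y)
    have nz: "psum f Y \<noteq> 0" using psum_pos[OF N, of Y] insert by auto
    have "linear_bf (E - Y - {e}) (minor_fun f (insert e Y))"
      unfolding minor_fun_insert[OF insert.hyps nz]
      using insert by (intro linear_bf_delete_element) auto
    moreover have "E - Y - {e} = E - insert e Y" by blast
    ultimately show ?case by simp
  qed
qed

text \<open>Descent on the ground set: pass to a nonlinear single-element contraction (growing
  \<open>X\<close>) or deletion (growing \<open>Y\<close>) while one exists; then
  \<open>minimal_nonlinear\<close> applies.\<close>

lemma nonlinear_has_U24_minor:
  assumes N: "nullity_like E f" and "X \<subseteq> E" "Y \<subseteq> E" "X \<inter> Y = {}"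
    and "\<not> linear_bf (E - X - Y) (minor_fun f Y)"
  shows "\<exists>X Y. X \<subseteq> E \<and> Y \<subseteq> E \<and> X \<inter> Y = {} \<and> isomorphic_bf (E - X - Y) (minor_fun f Y) E_U24 f_U24"
  using assms(2-)
proof (induction "card (E - X - Y)" arbitrary: X Y rule: less_induct)
  case less
  have fin: "finite E" using nullity_likeD(1)[OF N] .
  have finY: "finite Y" using less.prems fin finite_subset by blast
  have nz: "psum f Y \<noteq> 0" using psum_pos[OF N, of Y] less.prems by auto
  show ?case
  proof (cases "\<exists>e\<in>E - X - Y. \<not> linear_bf (E - insert e X - Y) (minor_fun f Y) \<or>
      \<not> linear_bf (E - X - insert e Y) (minor_fun f (insert e Y))")
    case True
    then obtain e where e: "e \<in> E - X - Y" and
      nl: "\<not> linear_bf (E - insert e X - Y) (minor_fun f Y) \<or>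
      \<not> linear_bf (E - X - insert e Y) (minor_fun f (insert e Y))" by blast
    have "E - insert e X - Y \<subset> E - X - Y" "E - X - insert e Y \<subset> E - X - Y"
      using e by blast+
    then have "card (E - insert e X - Y) < card (E - X - Y)"
      "card (E - X - insert e Y) < card (E - X - Y)"
      using fin by (simp_all add: psubset_card_mono)
    moreover have "insert e X \<subseteq> E" "insert e X \<inter> Y = {}" "insert e Y \<subseteq> E" "X \<inter> insert e Y = {}"
      using less.prems e by auto
    ultimately show ?thesis
      using nl less.hyps[of "insert e X" Y] less.hyps[of X "insert e Y"] less.prems(1,2) by metis
  next
    case False
    have "minimal_nonlinear (E - X - Y) (minor_fun f Y)"
    proof
      show "nullity_like (E - X - Y) (minor_fun f Y)"
        using nullity_like_minor_fun[OF N less.prems(2)]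
        by (rule nullity_like_subset) blast
      fix e assume e: "e \<in> E - X - Y"
      have eqs: "E - X - Y - {e} = E - insert e X - Y" "E - X - Y - {e} = E - X - insert e Y"
        by auto
      show "linear_bf (E - X - Y - {e}) (minor_fun f Y)"
        using False e unfolding eqs(1) by blast
      have "linear_bf (E - X - Y - {e}) (minor_fun f (insert e Y))"
        using False e unfolding eqs(2) by blast
      moreover have "e \<notin> Y" using e by blast
      ultimately show "linear_bf (E - X - Y - {e})
          (\<lambda>A. (minor_fun f Y A + minor_fun f Y (insert e A)) / (1 + minor_fun f Y {e}))"
        using minor_fun_insert[OF finY _ nz, of e] by simp
    qed (use less.prems in simp)
    then have "isomorphic_bf (E - X - Y) (minor_fun f Y) E_U24 f_U24"
      by (rule minimal_nonlinear.isomorphic_U24)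
    then show ?thesis
      using less.prems by blast
  qed
qed

text \<open>All arguments that occur lie in the domains of \<open>restrict\<close>, so its default
  value is never met.\<close>

lemma deletion_contraction_eq_minor_fun:
  assumes "Y \<subseteq> E - X" "A \<subseteq> E - X - Y"
  shows "deletion (E - X) (contraction E f X) Y A = minor_fun f Y A"
proof -
  have "contraction E f X (A \<union> Z) = f (A \<union> Z)" "contraction E f X Z = f Z" if "Z \<in> Pow Y" for Z
    using that assms unfolding contraction_def by auto
  then show ?thesis
    using assms unfolding deletion_def minor_fun_def psum_def by simp
qed

lemma deletion_well_defined_contraction:
  assumes "Y \<subseteq> E - X"
  shows "deletion_well_defined (contraction E f X) Y \<longleftrightarrow> psum f Y \<noteq> 0"
proof -
  have "contraction E f X Z = f Z" if "Z \<in> Pow Y" for Z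
    using that assms unfolding contraction_def by auto
  then show ?thesis
    unfolding deletion_well_defined_def psum_def by simp
qed

section \<open>From matroid rank functions to sums over subsets\<close>

text \<open>Starting from \<open>r {e} \<le> 1\<close>, submodularity preserves the bound on the
  increase as \<open>X\<close> grows; integrality leaves only 0 and 1.\<close>

lemma matroid_rank_unit_increase:
  assumes r: "matroid_rank_function E r" and "finite X" "X \<subseteq> E" "e \<in> E - X"
  shows "r (insert e X) = r X \<or> r (insert e X) = r X + 1"
proof -
  have nat: "r Z \<in> \<nat>" "r Z \<le> real (card Z)" if "Z \<subseteq> E" for Z
    using r that unfolding matroid_rank_function_def by auto
  have mono: "r Z \<le> r (insert x Z)" if "Z \<subseteq> E" "x \<in> E - Z" for x Z
    using r that unfolding matroid_rank_function_def by auto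
  have submod: "r Z + r (insert a (insert b Z)) \<le> r (insert a Z) + r (insert b Z)"
    if "Z \<subseteq> E" "a \<in> E - Z" "b \<in> E - Z" "a \<noteq> b" for a b Z
    using r that unfolding matroid_rank_function_def by auto
  have "r (insert e X) \<le> r X + 1"
    using assms(2-)
  proof (induction X rule: finite_induct)
    case empty
    have "0 \<le> r {}" using nat(1)[of "{}"] by (auto simp: Nats_def)
    then show ?case using nat(2)[of "{e}"] empty by auto
  next
    case (insert b X)
    then have "r (insert e X) \<le> r X + 1" by auto
    moreover have "r X + r (insert e (insert b X)) \<le> r (insert e X) + r (insert b X)"
      using insert by (intro submod) auto
    ultimately show ?case by linarith
  qed
  moreover have "r X \<le> r (insert e X)" using mono assms by blast
  moreover obtain m n where "r X = real m" "r (insert e X) = real n"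
    using nat(1)[of X] nat(1)[of "insert e X"] assms by (auto elim!: Nats_cases)
  ultimately show ?thesis by auto
qed

text \<open>The sum over \<open>W\<close> is 2 to the power \<open>r E - r (E - W)\<close>, so its
  growth is read off from shrinking complements.\<close>

lemma matroidal_nullity_like:
  assumes "binary_function E f" "matroidal E f"
  shows "nullity_like E f"
proof -
  have fin: "finite E" and f0: "f {} = 1"
    using assms(1) by (auto simp: binary_function_def)
  have rk: "rankable E f" and r: "matroid_rank_function E (Q E f)"
    using assms(2) by (auto simp: matroidal_def)
  define r where "r = Q E f"
  have S: "psum f E = 2 powr r (E - W) * psum f W" if W: "W \<subseteq> E" for W
  proof -
    have EW: "E - (E - W) = W" using W by blast
    have "rank_ratio E f (E - W) = psum f E / psum f W"
      by (simp add: rank_ratio_def psum_def EW)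
    moreover have "psum f W \<noteq> 0" "rank_ratio E f (E - W) > 0"
      using rk[unfolded rankable_def, rule_format, of "E - W"] by (simp_all add: psum_def EW)
    ultimately show ?thesis
      by (simp add: r_def Q_def field_simps)
  qed
  have step: "psum f (insert e W) = 2 powr (r (E - W) - r (E - insert e W)) * psum f W"
    if "W \<subseteq> E" "e \<in> E" for W e
    using S[of W] S[of "insert e W"] that by (simp add: powr_diff field_simps)
  have unit: "r (E - W) = r (E - insert e W) \<or> r (E - W) = r (E - insert e W) + 1"
    if "W \<subseteq> E" "e \<in> E - W" for W e
  proof -
    have "insert e (E - insert e W) = E - W" using that by blast
    then show ?thesis
      using matroid_rank_unit_increase[OF r, of "E - insert e W" e] fin that
      by (auto simp: r_def)
  qed
  have nz: "psum f W \<noteq> 0" if "W \<subseteq> E" for W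
    using rk[unfolded rankable_def, rule_format, of "E - W"] that
    by (simp add: psum_def double_diff)
  show ?thesis
    unfolding nullity_like_def
  proof (intro conjI allI ballI impI fin f0)
    fix W e assume "W \<subseteq> E" "e \<in> E - W"
    then show "psum f (insert e W) \<in> {psum f W, 2 * psum f W}"
      using step[of W e] unit[of W e] by auto
  next
    fix W a b assume W: "W \<subseteq> E" "a \<in> E - W" "b \<in> E - W" "a \<noteq> b"
      and d: "psum f (insert a W) = 2 * psum f W"
    have "r (E - W) = r (E - insert a W) + 1"
      using step[of W a] unit[of W a] d W nz[of W] by auto
    moreover define V where "V = E - insert a (insert b W)"
    have V: "insert a V = E - insert b W" "insert b V = E - insert a W" "V \<union> {a, b} = E - W"
      using W unfolding V_def by auto
    \<comment> \<open>By submodularity, removing \<open>a\<close> from \<open>E - insert b W\<close>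
      lowers the rank at least as much as removing it from \<open>E - W\<close>.\<close>
    have "r V + r (V \<union> {a, b}) \<le> r (V \<union> {a}) + r (V \<union> {b})"
      using r W unfolding matroid_rank_function_def r_def V_def by auto
    ultimately have "r (E - insert b W) = r V + 1"
      using unit[of "insert b W" a] W V by (auto simp: V_def)
    then show "psum f (insert a (insert b W)) = 2 * psum f (insert b W)"
      using step[of "insert b W" a] W by (simp add: V_def)
  qed
qed

theorem theorem13:
  fixes E :: "'a set" and f :: "'a set \<Rightarrow> real"
  assumes "binary_function E f"
    and "matroidal E f"
  shows "linear_bf E f \<longleftrightarrow>
    \<not> (\<exists>E' g. is_minor E' g E f \<and> isomorphic_bf E' g E_U24 f_U24)"
proof -
  have N: "nullity_like E f" using matroidal_nullity_like[OF assms] .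
  show ?thesis
  proof (intro iffI notI)
    assume lin: "linear_bf E f"
    assume "\<exists>E' g. is_minor E' g E f \<and> isomorphic_bf E' g E_U24 f_U24"
    then obtain X Y g where XY: "X \<subseteq> E" "Y \<subseteq> E" "X \<inter> Y = {}"
      and g: "g = deletion (E - X) (contraction E f X) Y"
      and iso: "isomorphic_bf (E - X - Y) g E_U24 f_U24"
      unfolding is_minor_def by blast
    \<comment> \<open>The test set is the whole ground set: its image is \<open>E_U24\<close>, where
      \<open>f_U24\<close> is -1, a value no linear function takes.\<close>
    then obtain \<phi> where \<phi>: "bij_betw \<phi> (E - X - Y) E_U24"
      "g (E - X - Y) = f_U24 (\<phi> ` (E - X - Y))"
      unfolding isomorphic_bf_def by blast
    then have "g (E - X - Y) = -1"
      by (simp add: bij_betw_imp_surj_on E_U24_def f_U24_def)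
    moreover have "Y \<subseteq> E - X" using XY by blast
    ultimately have "minor_fun f Y (E - X - Y) = -1"
      using deletion_contraction_eq_minor_fun[of Y E X "E - X - Y" f] g by simp
    moreover have "linear_bf (E - X - Y) (minor_fun f Y)"
      using linear_bf_minor_fun[OF N lin XY(2)] by (rule linear_bf_subset) blast
    then have "minor_fun f Y (E - X - Y) \<in> {0, 1}"
      unfolding linear_bf_def by blast
    ultimately show False by simp
  next
    assume no: "\<not> (\<exists>E' g. is_minor E' g E f \<and> isomorphic_bf E' g E_U24 f_U24)"
    show "linear_bf E f"
    proof (rule ccontr)
      assume "\<not> linear_bf E f"
      then have "\<not> linear_bf (E - {} - {}) (minor_fun f {})"
        using nullity_likeD(2)[OF N] by simp
      then obtain X Y where XY: "X \<subseteq> E" "Y \<subseteq> E" "X \<inter> Y = {}"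
        and iso: "isomorphic_bf (E - X - Y) (minor_fun f Y) E_U24 f_U24"
        using nonlinear_has_U24_minor[OF N, of "{}" "{}"] by auto
      define g where "g = deletion (E - X) (contraction E f X) Y"
      have Y: "Y \<subseteq> E - X" using XY by blast
      have "is_minor (E - X - Y) g E f"
        unfolding is_minor_def g_def
        using XY deletion_well_defined_contraction[OF Y, of f] psum_pos[OF N XY(2)]
        by (intro exI[of _ X] exI[of _ Y]) simp
      moreover have "isomorphic_bf (E - X - Y) g E_U24 f_U24"
        using iso deletion_contraction_eq_minor_fun[OF Y, of _ f]
        unfolding isomorphic_bf_def g_def by simp
      ultimately show False using no by blast
    qed
  qed
qed

end
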